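(* For a completely regular frame $L$, the following are equivalent: (1) $L$ is an almost $P$-frame. (2) The booleanization $\mathfrak{B}L$ is well-embedded in $L$. (3) The perfect regularization and the booleanization of $L$ coincide; that is, $\mathfrak{pR}L=\mathfrak{B}L$. (4) The perfect regularization $\mathfrak{pR}L$ is boolean. (5) $\mathrm{Coz}\,L$ is $\wedge$-subfit.
   Context: An element $a$ of a frame $L$ is a cozero element if $a=h(\mathbb{R}\setminus\{0\})$ for some frame homomorphism $h:\mathfrak{O}\mathbb{R}\to L$; $\mathrm{Coz}\,L$ is the set of cozero elements of $L$ with the induced order (closed under finite meets and countable joins in $L$). A frame $L$ is completely regular iff every element of $L$ is a join of cozero elements. A sublocale of $L$ is a subset $S\subseteq L$ closed under arbitrary meets such that $x\to s\in S$ for all $x\in L$, $s\in S$, where $\to$ is the Heyting implication of $L$; with the induced order it is itself a frame. A sublocale is dense if it contains $0_L$. The booleanization $\mathfrak{B}L=\{x^{**}\mid x\in L\}$ ($x^*$ the pseudocomplement of $x$) is the smallest dense sublocale of $L$. For a completely regular frame $L$, the perfect regularization $\mathfrak{pR}L$ is the smallest sublocale of $L$ containing $\mathrm{Coz}\,L$; its associated nucleus is $\mathfrak{p}(a)=\bigwedge\{c\in\mathrm{Coz}\,L\mid a\le c\}$. A dense sublocale $S$ of a completely regular frame $L$ is well-embedded iff $\mathrm{Coz}\,L\subseteq\mathrm{Coz}\,S$ (as subsets of $L$). A frame $L$ is almost $P$ if $\mathrm{Coz}\,L\subseteq\mathfrak{B}L$. A frame is boolean if it is a (complete) boolean algebra.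 A meet-semilattice $A$ with $0$ is $\wedge$-subfit if for all $a\nleq b$ in $A$ there exists $c\in A$ such that $c\wedge a\neq 0=c\wedge b$. *)

theory Defs
  imports Complex_Main "HOL-Algebra.Complete_Lattice"
begin

section \<open>Frames and frame homomorphisms\<close>

text \<open>
  Frames are carrier-based, as the complete lattices of \<^theory>\<open>HOL-Algebra.Complete_Lattice\<close>.
  A subset \<open>S\<close> of a frame \<open>L\<close> with the induced order is \<open>L\<lparr>carrier := S\<rparr>\<close>; top, bottom, meets and
  joins written with this structure are those computed inside \<open>S\<close>.
\<close>

locale frame = complete_lattice L for L (structure) +
  assumes meet_sup_distrib:
    "\<lbrakk>x \<in> carrier L; A \<subseteq> carrier L\<rbrakk> \<Longrightarrow> x \<sqinter> \<Squnion>A = \<Squnion>((\<lambda>a. x \<sqinter> a) ` A)"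

definition frame_hom ::
  "('a, 'c) gorder_scheme \<Rightarrow> ('b, 'd) gorder_scheme \<Rightarrow> ('a \<Rightarrow> 'b) set" where
  "frame_hom K L = {h. h \<in> carrier K \<rightarrow> carrier L
     \<and> h \<top>\<^bsub>K\<^esub> = \<top>\<^bsub>L\<^esub>
     \<and> (\<forall>x\<in>carrier K. \<forall>y\<in>carrier K. h (x \<sqinter>\<^bsub>K\<^esub> y) = h x \<sqinter>\<^bsub>L\<^esub> h y)
     \<and> (\<forall>A\<subseteq>carrier K. h (\<Squnion>\<^bsub>K\<^esub>A) = \<Squnion>\<^bsub>L\<^esub>(h ` A))}"

definition open_frame :: "'a::topological_space set gorder" where
  "open_frame = \<lparr>carrier = {U. open U}, eq = (=), le = (\<subseteq>)\<rparr>"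

definition boolean_frame :: "('a, 'c) gorder_scheme \<Rightarrow> bool" where
  "boolean_frame L \<longleftrightarrow> frame L \<and>
     (\<forall>x\<in>carrier L. \<exists>y\<in>carrier L. x \<sqinter>\<^bsub>L\<^esub> y = \<bottom>\<^bsub>L\<^esub> \<and> x \<squnion>\<^bsub>L\<^esub> y = \<top>\<^bsub>L\<^esub>)"

section \<open>Cozero elements\<close>

definition Coz :: "('a, 'c) gorder_scheme \<Rightarrow> 'a set" where
  "Coz L = {h (UNIV - {0}) | h. h \<in> frame_hom (open_frame :: real set gorder) L}"

definition completely_regular :: "('a, 'c) gorder_scheme \<Rightarrow> bool" where
  "completely_regular L \<longleftrightarrow> frame L \<and> (\<forall>a\<in>carrier L. \<exists>C\<subseteq>Coz L. a = \<Squnion>\<^bsub>L\<^esub>C)"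

section \<open>Sublocales\<close>

definition heyting_imp :: "('a, 'c) gorder_scheme \<Rightarrow> 'a \<Rightarrow> 'a \<Rightarrow> 'a" where
  "heyting_imp L x y = \<Squnion>\<^bsub>L\<^esub>{z \<in> carrier L. z \<sqinter>\<^bsub>L\<^esub> x \<sqsubseteq>\<^bsub>L\<^esub> y}"

definition pseudocomplement :: "('a, 'c) gorder_scheme \<Rightarrow> 'a \<Rightarrow> 'a" where
  "pseudocomplement L x = \<Squnion>\<^bsub>L\<^esub>{z \<in> carrier L. z \<sqinter>\<^bsub>L\<^esub> x = \<bottom>\<^bsub>L\<^esub>}"

text \<open>The case \<open>A = {}\<close> puts the top of \<open>L\<close> into every sublocale.\<close>

definition is_sublocale :: "('a, 'c) gorder_scheme \<Rightarrow> 'a set \<Rightarrow> bool" where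
  "is_sublocale L S \<longleftrightarrow> S \<subseteq> carrier L
     \<and> (\<forall>A\<subseteq>S. \<Sqinter>\<^bsub>L\<^esub>A \<in> S)
     \<and> (\<forall>x\<in>carrier L. \<forall>s\<in>S. heyting_imp L x s \<in> S)"

definition dense_sublocale :: "('a, 'c) gorder_scheme \<Rightarrow> 'a set \<Rightarrow> bool" where
  "dense_sublocale L S \<longleftrightarrow> is_sublocale L S \<and> \<bottom>\<^bsub>L\<^esub> \<in> S"

definition booleanization :: "('a, 'c) gorder_scheme \<Rightarrow> 'a set" where
  "booleanization L = {pseudocomplement L (pseudocomplement L x) | x. x \<in> carrier L}"

definition perfect_regularization :: "('a, 'c) gorder_scheme \<Rightarrow> 'a set" where
  "perfect_regularization L = \<Inter>{S. is_sublocale L S \<and> Coz L \<subseteq> S}"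

definition well_embedded :: "('a, 'c) gorder_scheme \<Rightarrow> 'a set \<Rightarrow> bool" where
  "well_embedded L S \<longleftrightarrow> dense_sublocale L S \<and> Coz L \<subseteq> Coz (L\<lparr>carrier := S\<rparr>)"

section \<open>Almost P-frames and subfitness\<close>

definition almost_P_frame :: "('a, 'c) gorder_scheme \<Rightarrow> bool" where
  "almost_P_frame L \<longleftrightarrow> frame L \<and> Coz L \<subseteq> booleanization L"

text \<open>
  Meant for subsets \<open>A\<close> of \<open>L\<close> that, like \<open>Coz L\<close>, are closed under the finite meets of \<open>L\<close>
  and contain its bottom: the meets and the zero of the meet-semilattice \<open>A\<close> are then those of \<open>L\<close>.
\<close>

definition meet_subfit :: "('a, 'c) gorder_scheme \<Rightarrow> 'a set \<Rightarrow> bool" where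
  "meet_subfit L A \<longleftrightarrow> (\<forall>a\<in>A. \<forall>b\<in>A. \<not> a \<sqsubseteq>\<^bsub>L\<^esub> b \<longrightarrow>
     (\<exists>c\<in>A. c \<sqinter>\<^bsub>L\<^esub> a \<noteq> \<bottom>\<^bsub>L\<^esub> \<and> c \<sqinter>\<^bsub>L\<^esub> b = \<bottom>\<^bsub>L\<^esub>))"

section \<open>Consistency of the definitions\<close>

lemma complete_lattice_open_frame: "complete_lattice (open_frame :: 'a::topological_space set gorder)"
proof -
  interpret partial_order "open_frame :: 'a set gorder"
    by unfold_locales (auto simp: open_frame_def)
  show ?thesis
  proof (rule complete_latticeI)
    fix A :: "'a set set" assume "A \<subseteq> carrier open_frame"
    then have o: "\<forall>U\<in>A. open U" by (auto simp: open_frame_def)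
    then have "least open_frame (\<Union>A) (Upper open_frame A)"
      by (auto simp: least_def Upper_def open_frame_def)
    then show "\<exists>s. least open_frame s (Upper open_frame A)" ..
    have "greatest open_frame (\<Union>{U. open U \<and> U \<subseteq> \<Inter>A}) (Lower open_frame A)"
      using o by (auto simp: greatest_def Lower_def open_frame_def)
    then show "\<exists>i. greatest open_frame i (Lower open_frame A)" ..
  qed
qed

lemma open_frame_sup:
  assumes "\<And>U. U \<in> A \<Longrightarrow> open U"
  shows "\<Squnion>\<^bsub>open_frame\<^esub>A = \<Union>A"
proof -
  interpret complete_lattice "open_frame :: 'a set gorder" by (rule complete_lattice_open_frame)
  have A: "A \<subseteq> carrier open_frame" using assms by (auto simp: open_frame_def)
  have "least open_frame (\<Union>A) (Upper open_frame A)"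
    using assms by (auto simp: least_def Upper_def open_frame_def)
  from least_unique[OF this sup_lub[OF A]] show ?thesis by simp
qed

lemma open_frame_meet:
  assumes "open U" "open V"
  shows "U \<sqinter>\<^bsub>open_frame\<^esub> V = U \<inter> V"
proof -
  interpret complete_lattice "open_frame :: 'a set gorder" by (rule complete_lattice_open_frame)
  have A: "{U, V} \<subseteq> carrier open_frame" using assms by (auto simp: open_frame_def)
  have "greatest open_frame (U \<inter> V) (Lower open_frame {U, V})"
    using assms by (auto simp: greatest_def Lower_def open_frame_def)
  from greatest_unique[OF this inf_glb[OF A]] show ?thesis by (simp add: meet_def)
qed

lemma open_frame_top: "\<top>\<^bsub>open_frame\<^esub> = UNIV"
proof -
  interpret complete_lattice "open_frame :: 'a set gorder" by (rule complete_lattice_open_frame)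
  have "UNIV \<sqsubseteq>\<^bsub>open_frame\<^esub> (\<top>\<^bsub>open_frame\<^esub> :: 'a set)"
    by (rule top_higher) (simp add: open_frame_def)
  then show ?thesis by (auto simp: open_frame_def)
qed

lemma frame_open_frame: "frame (open_frame :: 'a::topological_space set gorder)"
proof (intro frame.intro frame_axioms.intro complete_lattice_open_frame)
  fix x :: "'a set" and A :: "'a set set"
  assume "x \<in> carrier open_frame" "A \<subseteq> carrier open_frame"
  then have x: "open x" and A: "\<And>U. U \<in> A \<Longrightarrow> open U" by (auto simp: open_frame_def)
  then have im: "(\<lambda>a. x \<sqinter>\<^bsub>open_frame\<^esub> a) ` A = (\<lambda>a. x \<inter> a) ` A"
    by (intro image_cong refl open_frame_meet)
  have s: "\<Squnion>\<^bsub>open_frame\<^esub>((\<lambda>a. x \<inter> a) ` A) = \<Union>((\<lambda>a. x \<inter> a) ` A)"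
    by (rule open_frame_sup) (use x A in auto)
  have "x \<sqinter>\<^bsub>open_frame\<^esub> \<Squnion>\<^bsub>open_frame\<^esub>A = x \<inter> \<Union>A"
    using x A by (subst open_frame_sup) (auto intro!: open_frame_meet)
  then show "x \<sqinter>\<^bsub>open_frame\<^esub> \<Squnion>\<^bsub>open_frame\<^esub>A = \<Squnion>\<^bsub>open_frame\<^esub>((\<lambda>a. x \<sqinter>\<^bsub>open_frame\<^esub> a) ` A)"
    unfolding im s by auto
qed

context frame
begin

lemma heyting_imp_closed: "heyting_imp L x y \<in> carrier L"
  unfolding heyting_imp_def by (rule sup_closed) auto

lemma heyting_imp_adjoint:
  assumes x: "x \<in> carrier L" and y: "y \<in> carrier L" and z: "z \<in> carrier L"
  shows "z \<sqsubseteq> heyting_imp L x y \<longleftrightarrow> z \<sqinter> x \<sqsubseteq> y"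
proof
  let ?Z = "{z \<in> carrier L. z \<sqinter> x \<sqsubseteq> y}"
  assume le: "z \<sqsubseteq> heyting_imp L x y"
  have i: "heyting_imp L x y \<in> carrier L" by (rule heyting_imp_closed)
  have "x \<sqinter> heyting_imp L x y = \<Squnion>((\<lambda>a. x \<sqinter> a) ` ?Z)"
    unfolding heyting_imp_def by (rule meet_sup_distrib[OF x]) auto
  also have "\<dots> \<sqsubseteq> y"
    by (rule sup_least) (use x y in \<open>auto simp: meet_comm[of L x]\<close>)
  finally have *: "x \<sqinter> heyting_imp L x y \<sqsubseteq> y" .
  have "z \<sqinter> x \<sqsubseteq> x \<sqinter> heyting_imp L x y"
  proof (rule meet_le)
    show "z \<sqinter> x \<sqsubseteq> x" by (rule meet_right[OF z x])
    show "z \<sqinter> x \<sqsubseteq> heyting_imp L x y"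
      by (rule le_trans[OF meet_left[OF z x] le]) (use x z i in simp_all)
  qed (use x z i in simp_all)
  with * show "z \<sqinter> x \<sqsubseteq> y" using x y z i by (meson le_trans meet_closed)
next
  assume "z \<sqinter> x \<sqsubseteq> y"
  with z show "z \<sqsubseteq> heyting_imp L x y"
    unfolding heyting_imp_def by (intro sup_upper) auto
qed

lemma is_sublocale_carrier: "is_sublocale L (carrier L)"
  unfolding is_sublocale_def using heyting_imp_closed by auto

lemma frame_sublocale:
  assumes "is_sublocale L S"
  shows "frame (L\<lparr>carrier := S\<rparr>)"
proof -
  let ?S = "L\<lparr>carrier := S\<rparr>"
  have S: "S \<subseteq> carrier L"
    and infS: "\<And>A. A \<subseteq> S \<Longrightarrow> \<Sqinter>A \<in> S"
    and impS: "\<And>x s. x \<in> carrier L \<Longrightarrow> s \<in> S \<Longrightarrow> heyting_imp L x s \<in> S"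
    using assms unfolding is_sublocale_def by auto
  interpret S: partial_order ?S
    using weak_partial_order_subset[OF weak_partial_order_axioms S]
    by (simp add: partial_order_def partial_order_axioms_def eq_is_equal)
  have glb: "greatest ?S (\<Sqinter>A) (Lower ?S A)" if "A \<subseteq> S" for A
  proof -
    have A: "A \<subseteq> carrier L" using that S by auto
    show ?thesis
      unfolding greatest_def Lower_def
      using that infS[OF that] inf_lower[OF A] S by (auto intro!: inf_greatest[OF A])
  qed
  interpret S: complete_lattice ?S
  proof (rule S.complete_lattice_criterion1)
    show "\<exists>g. greatest ?S g (carrier ?S)"
      using glb[of "{}"] by auto
    show "\<exists>i. greatest ?S i (Lower ?S A)" if "A \<subseteq> carrier ?S" for A
      using glb[of A] that by auto
  qed
  have meet: "x \<sqinter>\<^bsub>?S\<^esub> y = x \<sqinter> y" if "x \<in> S" "y \<in> S" for x y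
  proof -
    have "\<Sqinter>{x, y} = \<Sqinter>\<^bsub>?S\<^esub>{x, y}"
      using S.greatest_unique[OF glb[of "{x, y}"] S.inf_glb[of "{x, y}"]] that by simp
    then show ?thesis by (simp add: meet_def)
  qed
  show ?thesis
  proof unfold_locales
    fix x A assume "x \<in> carrier ?S" "A \<subseteq> carrier ?S"
    then have x: "x \<in> S" and A: "A \<subseteq> S" by auto
    let ?j = "\<Squnion>\<^bsub>?S\<^esub>A"
    let ?B = "(\<lambda>a. x \<sqinter>\<^bsub>?S\<^esub> a) ` A"
    let ?k = "\<Squnion>\<^bsub>?S\<^esub>?B"
    have B: "?B \<subseteq> carrier ?S" using x A S.meet_closed by auto
    have j: "?j \<in> S" using S.sup_closed[of A] A by simp
    have k: "?k \<in> S" using S.sup_closed[OF B] by simp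
    have "a \<sqsubseteq> heyting_imp L x ?k" if "a \<in> A" for a
    proof -
      have "x \<sqinter>\<^bsub>?S\<^esub> a \<sqsubseteq>\<^bsub>?S\<^esub> ?k" by (rule S.sup_upper[OF B]) (use that in auto)
      then have "a \<sqinter> x \<sqsubseteq> ?k"
        using meet[of x a] x that A by (auto simp: meet_comm[of L a])
      then show ?thesis using heyting_imp_adjoint[of x ?k a] subsetD[OF S] subsetD[OF A that] x k by blast
    qed
    then have "?j \<sqsubseteq>\<^bsub>?S\<^esub> heyting_imp L x ?k"
      by (intro S.sup_least) (use A x k S impS in auto)
    then have "?j \<sqinter> x \<sqsubseteq> ?k" using heyting_imp_adjoint[of x ?k ?j] subsetD[OF S] x k j by simp
    moreover have "x \<sqinter>\<^bsub>?S\<^esub> ?j = ?j \<sqinter> x" by (rule HOL.trans[OF meet[OF x j] meet_comm])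
    ultimately have 1: "x \<sqinter>\<^bsub>?S\<^esub> ?j \<sqsubseteq>\<^bsub>?S\<^esub> ?k" by simp
    have "b \<sqsubseteq>\<^bsub>?S\<^esub> x \<sqinter>\<^bsub>?S\<^esub> ?j" if "b \<in> ?B" for b
    proof -
      from that obtain a where a: "a \<in> A" "b = x \<sqinter>\<^bsub>?S\<^esub> a" by auto
      have aj: "a \<sqsubseteq>\<^bsub>?S\<^esub> ?j" by (rule S.sup_upper) (use a A in auto)
      have c: "x \<in> carrier ?S" "a \<in> carrier ?S" "?j \<in> carrier ?S" using x a A j by auto
      show ?thesis unfolding a(2)
      proof (rule S.meet_le)
        show "x \<sqinter>\<^bsub>?S\<^esub> a \<sqsubseteq>\<^bsub>?S\<^esub> x" by (rule S.meet_left[OF c(1,2)])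
        show "x \<sqinter>\<^bsub>?S\<^esub> a \<sqsubseteq>\<^bsub>?S\<^esub> ?j"
          by (rule S.le_trans[OF S.meet_right[OF c(1,2)] aj S.meet_closed[OF c(1,2)] c(2,3)])
      qed (fact c S.meet_closed[OF c(1,2)])+
    qed
    then have 2: "?k \<sqsubseteq>\<^bsub>?S\<^esub> x \<sqinter>\<^bsub>?S\<^esub> ?j"
      by (intro S.sup_least[OF B]) (use x j S.meet_closed[of x ?j] in auto)
    show "x \<sqinter>\<^bsub>?S\<^esub> ?j = ?k"
      by (rule S.le_antisym[OF 1 2]) (use x j k S.meet_closed[of x ?j] in auto)
  qed
qed

lemma Coz_subset: "Coz L \<subseteq> carrier L"
proof -
  have "open (UNIV - {0 :: real})" by auto
  then show ?thesis
    unfolding Coz_def frame_hom_def open_frame_def by (auto simp: Pi_iff)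
qed

lemma is_sublocale_perfect_regularization: "is_sublocale L (perfect_regularization L)"
proof -
  let ?F = "{S. is_sublocale L S \<and> Coz L \<subseteq> S}"
  have F: "is_sublocale L S" if "S \<in> ?F" for S using that by simp
  have "carrier L \<in> ?F" using is_sublocale_carrier Coz_subset by simp
  then have "\<Inter>?F \<subseteq> carrier L" by (rule Inter_lower)
  moreover have "\<Sqinter>A \<in> \<Inter>?F" if "A \<subseteq> \<Inter>?F" for A
  proof (rule InterI)
    fix S assume S: "S \<in> ?F"
    with that have "A \<subseteq> S" by (meson Inter_lower subset_trans)
    then show "\<Sqinter>A \<in> S" using F[OF S] by (simp add: is_sublocale_def)
  qed
  moreover have "heyting_imp L x s \<in> \<Inter>?F" if "x \<in> carrier L" "s \<in> \<Inter>?F" for x s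
  proof (rule InterI)
    fix S assume S: "S \<in> ?F"
    with that(2) have "s \<in> S" by (rule InterD)
    then show "heyting_imp L x s \<in> S" using F[OF S] that(1) by (simp add: is_sublocale_def)
  qed
  ultimately show ?thesis
    unfolding perfect_regularization_def by (simp add: is_sublocale_def)
qed

lemma Coz_subset_perfect_regularization: "Coz L \<subseteq> perfect_regularization L"
  unfolding perfect_regularization_def by blast

lemma perfect_regularization_least:
  "is_sublocale L S \<Longrightarrow> Coz L \<subseteq> S \<Longrightarrow> perfect_regularization L \<subseteq> S"
  unfolding perfect_regularization_def by blast

end

end

theory Submission
  imports Defs
begin

text \<open>
  Everything rests on the regular elements \<open>a = a\<^sup>*\<^sup>*\<close>, which make up \<open>booleanization L\<close>. Double
  pseudocomplementation is a frame homomorphism from \<open>L\<close> onto the booleanization fixing these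
  elements, so it turns a homomorphism witnessing that a regular \<open>a\<close> is cozero in \<open>L\<close> into one
  witnessing that \<open>a\<close> is cozero in the booleanization. Since \<open>\<bottom>\<close> is cozero, the perfect
  regularization is dense and so contains the booleanization; and a dense boolean sublocale has only
  regular elements. For subfitness, complete regularity is used to shrink the regular elements
  \<open>b\<^sup>*\<close> and \<open>a\<^sup>*\<^sup>*\<close> to cozero elements that still witness the relevant non-inclusion.
\<close>

section \<open>Frame homomorphisms and their action on cozero elements\<close>

lemma frame_hom_compose:
  assumes h: "h \<in> frame_hom K L" and k: "k \<in> frame_hom L M"
  shows "k \<circ> h \<in> frame_hom K M"
proof -
  have hc: "h \<in> carrier K \<rightarrow> carrier L" using h by (simp add: frame_hom_def)
  have "(k \<circ> h) (\<Squnion>\<^bsub>K\<^esub>A) = \<Squnion>\<^bsub>M\<^esub>((k \<circ> h) ` A)" if "A \<subseteq> carrier K" for A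
  proof -
    have "h ` A \<subseteq> carrier L" using hc that by auto
    then have "k (\<Squnion>\<^bsub>L\<^esub>(h ` A)) = \<Squnion>\<^bsub>M\<^esub>(k ` h ` A)"
      using k by (simp add: frame_hom_def)
    then show ?thesis using h that by (simp add: frame_hom_def image_comp)
  qed
  with h k hc show ?thesis by (auto simp: frame_hom_def Pi_iff)
qed

text \<open>The composite of \<open>k\<close> with the homomorphism that witnesses \<open>a\<close>
  is a witness for \<open>k a\<close>.\<close>

lemma frame_hom_Coz: "k \<in> frame_hom L M \<Longrightarrow> a \<in> Coz L \<Longrightarrow> k a \<in> Coz M"
  unfolding Coz_def by clarify (metis frame_hom_compose o_apply)

context frame
begin

section \<open>Calculus of pseudocomplements in a frame\<close>

abbreviation pc :: "'a \<Rightarrow> 'a" where "pc \<equiv> pseudocomplement L"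

lemma le_bottom_iff: "x \<in> carrier L \<Longrightarrow> x \<sqsubseteq> \<bottom> \<longleftrightarrow> x = \<bottom>"
  using le_antisym[of x \<bottom>] bottom_lower[of x] by auto

text \<open>Makes the Heyting adjunction, and the closure of sublocales under implication, available
  for pseudocomplements.\<close>

lemma pseudocomplement_eq_heyting_imp:
  assumes "x \<in> carrier L" shows "pc x = heyting_imp L x \<bottom>"
proof -
  have "{z \<in> carrier L. z \<sqinter> x = \<bottom>} = {z \<in> carrier L. z \<sqinter> x \<sqsubseteq> \<bottom>}"
    using assms le_bottom_iff meet_closed by auto
  then show ?thesis by (simp add: pseudocomplement_def heyting_imp_def)
qed

lemma pseudocomplement_closed [simp]: "pc x \<in> carrier L"
  unfolding pseudocomplement_def by (rule sup_closed) auto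

lemma le_pseudocomplement_iff:
  assumes "x \<in> carrier L" "z \<in> carrier L"
  shows "z \<sqsubseteq> pc x \<longleftrightarrow> z \<sqinter> x = \<bottom>"
  using assms heyting_imp_adjoint[of x \<bottom> z] le_bottom_iff meet_closed
  by (simp add: pseudocomplement_eq_heyting_imp)

lemma meet_pseudocomplement: "x \<in> carrier L \<Longrightarrow> pc x \<sqinter> x = \<bottom>"
  using le_pseudocomplement_iff[of x "pc x"] by simp

text \<open>Disjointness is symmetric, so \<open>pc\<close> forms an antitone Galois connection with
  itself. The laws up to \<open>triple_pseudocomplement\<close> follow formally from this.\<close>

lemma le_pseudocomplement_commute:
  "x \<in> carrier L \<Longrightarrow> y \<in> carrier L \<Longrightarrow> x \<sqsubseteq> pc y \<longleftrightarrow> y \<sqsubseteq> pc x"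
  by (simp add: le_pseudocomplement_iff meet_comm[of L x])

lemma le_double_pseudocomplement: "x \<in> carrier L \<Longrightarrow> x \<sqsubseteq> pc (pc x)"
  using le_pseudocomplement_commute[of "pc x" x] by simp

lemma pseudocomplement_antimono:
  assumes "x \<in> carrier L" "y \<in> carrier L" "x \<sqsubseteq> y" shows "pc y \<sqsubseteq> pc x"
proof -
  have "x \<sqsubseteq> pc (pc y)"
    by (rule le_trans[OF assms(3) le_double_pseudocomplement]) (use assms in auto)
  then show ?thesis using le_pseudocomplement_commute[of x "pc y"] assms by simp
qed

lemma triple_pseudocomplement:
  assumes "x \<in> carrier L" shows "pc (pc (pc x)) = pc x"
  using assms
  by (intro le_antisym pseudocomplement_antimono le_double_pseudocomplement) auto

text \<open>Disjointness from \<open>x\<close> means lying below \<open>pc x\<close>, which by the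
  triple law is the same as disjointness from \<open>pc (pc x)\<close>.\<close>

lemma meet_double_pseudocomplement_eq_bottom:
  assumes "x \<in> carrier L" "y \<in> carrier L" "y \<sqinter> x = \<bottom>"
  shows "y \<sqinter> pc (pc x) = \<bottom>"
  using assms le_pseudocomplement_iff[of "pc (pc x)" y] le_pseudocomplement_iff[of x y]
  by (simp add: triple_pseudocomplement)

lemma double_pseudocomplement_mono:
  "x \<in> carrier L \<Longrightarrow> y \<in> carrier L \<Longrightarrow> x \<sqsubseteq> y \<Longrightarrow> pc (pc x) \<sqsubseteq> pc (pc y)"
  by (simp add: pseudocomplement_antimono)

lemma double_pseudocomplement_meet:
  assumes x: "x \<in> carrier L" and y: "y \<in> carrier L"
  shows "pc (pc (x \<sqinter> y)) = pc (pc x) \<sqinter> pc (pc y)"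
proof (rule le_antisym)
  let ?w = "pc (x \<sqinter> y)"
  have c: "x \<sqinter> y \<in> carrier L" by (rule meet_closed[OF x y])
  show "pc ?w \<sqsubseteq> pc (pc x) \<sqinter> pc (pc y)"
    using x y c meet_left[OF x y] meet_right[OF x y]
    by (intro meet_le double_pseudocomplement_mono) auto
  \<comment> \<open>The disjointness of \<open>?w\<close>, \<open>x\<close> and \<open>y\<close>
    survives replacing first \<open>y\<close> and then \<open>x\<close> by its double
    pseudocomplement; this yields the inequality that monotonicity does not give.\<close>
  have "(?w \<sqinter> x) \<sqinter> y = \<bottom>"
    using meet_pseudocomplement[OF c] x y by (simp add: meet_assoc)
  then have "(?w \<sqinter> x) \<sqinter> pc (pc y) = \<bottom>"
    by (intro meet_double_pseudocomplement_eq_bottom) (use x y meet_closed in auto)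
  then have "(?w \<sqinter> pc (pc y)) \<sqinter> x = \<bottom>"
    using x y by (simp add: meet_assoc meet_comm[of L x])
  then have "(?w \<sqinter> pc (pc y)) \<sqinter> pc (pc x) = \<bottom>"
    by (intro meet_double_pseudocomplement_eq_bottom) (use x y meet_closed in auto)
  then have "(pc (pc x) \<sqinter> pc (pc y)) \<sqinter> ?w = \<bottom>"
    by (simp add: meet_assoc meet_comm[of L _ ?w] meet_comm[of L "pc (pc x)"])
  then show "pc (pc x) \<sqinter> pc (pc y) \<sqsubseteq> pc ?w"
    by (simp add: le_pseudocomplement_iff meet_closed)
qed (use x y meet_closed in auto)

lemma pseudocomplement_bottom: "pc \<bottom> = \<top>"
proof (rule le_antisym)
  have "\<top> \<sqinter> \<bottom> = \<bottom>" using meet_right[of \<top> \<bottom>] le_bottom_iff meet_closed by simp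
  then show "\<top> \<sqsubseteq> pc \<bottom>" by (simp add: le_pseudocomplement_iff)
qed auto

text \<open>If \<open>x\<close> were disjoint from every member of \<open>A\<close>, all members and
  hence \<open>\<Squnion>A\<close> would lie below \<open>pc x\<close>. This serves to pick, from a
  join of cozero elements, one that meets \<open>x\<close>.\<close>

lemma meet_sup_neq_bottom:
  assumes x: "x \<in> carrier L" and A: "A \<subseteq> carrier L" and ne: "x \<sqinter> \<Squnion>A \<noteq> \<bottom>"
  shows "\<exists>a\<in>A. x \<sqinter> a \<noteq> \<bottom>"
proof (rule ccontr)
  assume "\<not> ?thesis"
  then have "a \<sqsubseteq> pc x" if "a \<in> A" for a
    using that x A le_pseudocomplement_iff[of x a] meet_comm[of L x a] by auto
  then have "\<Squnion>A \<sqsubseteq> pc x" by (intro sup_least A) auto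
  then show False
    using ne x A le_pseudocomplement_iff[of x "\<Squnion>A"] meet_comm[of L x] by simp
qed

section \<open>The booleanization as the least dense sublocale\<close>

lemma mem_booleanization_iff: "a \<in> booleanization L \<longleftrightarrow> a \<in> carrier L \<and> pc (pc a) = a"
  unfolding booleanization_def by (auto simp: triple_pseudocomplement) metis

lemma pseudocomplement_mem_booleanization: "x \<in> carrier L \<Longrightarrow> pc x \<in> booleanization L"
  by (simp add: mem_booleanization_iff triple_pseudocomplement)

text \<open>The bottom is itself a pseudocomplement, namely that of \<open>\<top>\<close>.\<close>

lemma bottom_mem_booleanization: "\<bottom> \<in> booleanization L"
proof -
  have "pc \<top> = pc \<top> \<sqinter> \<top>"
    using le_iff_join[of "pc \<top>" \<top>] top_higher[of "pc \<top>"] by simp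
  then have "pc \<top> = \<bottom>" using meet_pseudocomplement[of \<top>] by simp
  then show ?thesis using pseudocomplement_mem_booleanization[of \<top>] by simp
qed

lemma is_sublocale_booleanization: "is_sublocale L (booleanization L)"
  unfolding is_sublocale_def
proof (intro conjI allI ballI impI)
  show "booleanization L \<subseteq> carrier L" by (auto simp: mem_booleanization_iff)
next
  fix A assume "A \<subseteq> booleanization L"
  then have A: "A \<subseteq> carrier L" and reg: "\<And>a. a \<in> A \<Longrightarrow> pc (pc a) = a"
    by (auto simp: mem_booleanization_iff)
  \<comment> \<open>Double pseudocomplementation is monotone and fixes \<open>a\<close>, so
    \<open>pc (pc (\<Sqinter>A))\<close> is still a lower bound of \<open>A\<close> and cannot
    exceed \<open>\<Sqinter>A\<close>.\<close>
  have "pc (pc (\<Sqinter>A)) \<sqsubseteq> a" if "a \<in> A" for a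
    using double_pseudocomplement_mono[of "\<Sqinter>A" a] reg[OF that] that A inf_lower[OF A that]
    by auto
  then have "pc (pc (\<Sqinter>A)) \<sqsubseteq> \<Sqinter>A" by (intro inf_greatest A) auto
  then show "\<Sqinter>A \<in> booleanization L"
    using A le_double_pseudocomplement[of "\<Sqinter>A"]
    by (auto simp: mem_booleanization_iff intro: le_antisym)
next
  fix x s assume x: "x \<in> carrier L" and "s \<in> booleanization L"
  then have s: "s \<in> carrier L" and reg: "pc (pc s) = s" by (auto simp: mem_booleanization_iff)
  have c: "x \<sqinter> pc s \<in> carrier L" using x meet_closed by simp
  \<comment> \<open>Since \<open>s\<close> is the pseudocomplement of \<open>pc s\<close>, lying
    below \<open>s\<close> is disjointness from \<open>pc s\<close>. The implication into
    \<open>s\<close> is therefore a pseudocomplement, that of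
    \<open>x \<sqinter> pc s\<close>.\<close>
  have eq: "z \<sqsubseteq> heyting_imp L x s \<longleftrightarrow> z \<sqsubseteq> pc (x \<sqinter> pc s)" if z: "z \<in> carrier L" for z
  proof -
    have "z \<sqinter> x \<sqsubseteq> s \<longleftrightarrow> (z \<sqinter> x) \<sqinter> pc s = \<bottom>"
      using le_pseudocomplement_iff[of "pc s" "z \<sqinter> x"] x z meet_closed by (simp add: reg)
    then show ?thesis
      using x s z c by (simp add: heyting_imp_adjoint le_pseudocomplement_iff meet_assoc)
  qed
  have "heyting_imp L x s = pc (x \<sqinter> pc s)"
    using eq[of "heyting_imp L x s"] eq[of "pc (x \<sqinter> pc s)"] heyting_imp_closed[of x s]
    by (intro le_antisym) auto
  then show "heyting_imp L x s \<in> booleanization L"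
    using pseudocomplement_mem_booleanization[OF c] by simp
qed

text \<open>A regular \<open>a\<close> is the implication from \<open>pc a\<close> into
  \<open>\<bottom>\<close>, and a sublocale containing \<open>\<bottom>\<close> contains every such
  implication.\<close>

lemma booleanization_subset_dense_sublocale:
  assumes "dense_sublocale L S" shows "booleanization L \<subseteq> S"
proof
  fix a assume "a \<in> booleanization L"
  then have "a = heyting_imp L (pc a) \<bottom>"
    by (simp add: mem_booleanization_iff pseudocomplement_eq_heyting_imp[symmetric])
  then show "a \<in> S"
    using assms pseudocomplement_closed[of a]
    unfolding dense_sublocale_def is_sublocale_def by metis
qed

section \<open>Meets, joins, top and bottom computed inside a sublocale\<close>

lemma sublocale_meet:
  assumes S: "is_sublocale L S" and xy: "x \<in> S" "y \<in> S"
  shows "x \<sqinter>\<^bsub>L\<lparr>carrier := S\<rparr>\<^esub> y = x \<sqinter> y"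
proof -
  let ?S = "L\<lparr>carrier := S\<rparr>"
  interpret S: frame ?S by (rule frame_sublocale[OF S])
  have sub: "S \<subseteq> carrier L" and m: "x \<sqinter> y \<in> S"
    using S xy unfolding is_sublocale_def meet_def by auto
  have c: "x \<in> carrier L" "y \<in> carrier L" using sub xy by auto
  have mS: "x \<sqinter>\<^bsub>?S\<^esub> y \<in> S" using S.meet_closed[of x y] xy by simp
  show ?thesis
  proof (rule le_antisym)
    show "x \<sqinter>\<^bsub>?S\<^esub> y \<sqsubseteq> x \<sqinter> y"
      using S.meet_left[of x y] S.meet_right[of x y] xy c mS sub by (intro meet_le) auto
    show "x \<sqinter> y \<sqsubseteq> x \<sqinter>\<^bsub>?S\<^esub> y"
      using S.meet_le[of "x \<sqinter> y" x y] meet_left[OF c] meet_right[OF c] xy m by simp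
  qed (use sub m mS in auto)
qed

lemma sublocale_top:
  assumes S: "is_sublocale L S"
  shows "\<top>\<^bsub>L\<lparr>carrier := S\<rparr>\<^esub> = \<top>"
proof -
  let ?S = "L\<lparr>carrier := S\<rparr>"
  interpret S: frame ?S by (rule frame_sublocale[OF S])
  have sub: "S \<subseteq> carrier L" and "\<Sqinter>{} \<in> S" using S unfolding is_sublocale_def by auto
  moreover have "\<Sqinter>{} = \<top>"
    by (intro le_antisym inf_greatest) auto
  ultimately have t: "\<top> \<in> S" by simp
  have tS: "\<top>\<^bsub>?S\<^esub> \<in> S" using S.top_closed by simp
  show ?thesis
    using S.top_higher[of \<top>] t tS sub by (intro le_antisym) auto
qed

lemma dense_sublocale_bottom:
  assumes "dense_sublocale L S"
  shows "\<bottom>\<^bsub>L\<lparr>carrier := S\<rparr>\<^esub> = \<bottom>"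
proof -
  let ?S = "L\<lparr>carrier := S\<rparr>"
  have S: "is_sublocale L S" and b: "\<bottom> \<in> S" using assms by (auto simp: dense_sublocale_def)
  interpret S: frame ?S by (rule frame_sublocale[OF S])
  have sub: "S \<subseteq> carrier L" using S unfolding is_sublocale_def by auto
  have bS: "\<bottom>\<^bsub>?S\<^esub> \<in> S" using S.bottom_closed by simp
  show ?thesis
    using S.bottom_lower[of \<bottom>] b bS sub by (intro le_antisym) auto
qed

lemma dense_sublocale_booleanization: "dense_sublocale L (booleanization L)"
  by (simp add: dense_sublocale_def is_sublocale_booleanization bottom_mem_booleanization)

text \<open>A regular element lies above \<open>a\<close> exactly when it lies above
  \<open>pc (pc a)\<close>. So the join inside the booleanization is the least regular element above
  \<open>A\<close>, which may exceed the join in \<open>L\<close>.\<close>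

lemma booleanization_sup:
  assumes A: "A \<subseteq> carrier L"
  shows "\<Squnion>\<^bsub>L\<lparr>carrier := booleanization L\<rparr>\<^esub>((\<lambda>a. pc (pc a)) ` A) = pc (pc (\<Squnion>A))"
proof -
  let ?B = "L\<lparr>carrier := booleanization L\<rparr>"
  let ?X = "(\<lambda>a. pc (pc a)) ` A"
  interpret B: frame ?B by (rule frame_sublocale[OF is_sublocale_booleanization])
  have X: "?X \<subseteq> carrier ?B" using pseudocomplement_mem_booleanization by auto
  have sB: "\<Squnion>\<^bsub>?B\<^esub>?X \<in> booleanization L" using B.sup_closed[OF X] by simp
  then have s: "\<Squnion>\<^bsub>?B\<^esub>?X \<in> carrier L" "pc (pc (\<Squnion>\<^bsub>?B\<^esub>?X)) = \<Squnion>\<^bsub>?B\<^esub>?X"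
    by (auto simp: mem_booleanization_iff)
  show ?thesis
  proof (rule le_antisym)
    have "\<Squnion>\<^bsub>?B\<^esub>?X \<sqsubseteq>\<^bsub>?B\<^esub> pc (pc (\<Squnion>A))"
      using A sup_upper[OF A] subsetD[OF A]
      by (intro B.sup_least[OF X]) (auto intro!: double_pseudocomplement_mono
          pseudocomplement_mem_booleanization)
    then show "\<Squnion>\<^bsub>?B\<^esub>?X \<sqsubseteq> pc (pc (\<Squnion>A))" by simp
    have "a \<sqsubseteq> \<Squnion>\<^bsub>?B\<^esub>?X" if "a \<in> A" for a
    proof -
      have "pc (pc a) \<sqsubseteq> \<Squnion>\<^bsub>?B\<^esub>?X" using B.sup_upper[OF X, of "pc (pc a)"] that by simp
      then show ?thesis
        using le_trans[OF le_double_pseudocomplement[of a]] that A s(1) by auto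
    qed
    then have "\<Squnion>A \<sqsubseteq> \<Squnion>\<^bsub>?B\<^esub>?X" by (intro sup_least A s(1))
    then show "pc (pc (\<Squnion>A)) \<sqsubseteq> \<Squnion>\<^bsub>?B\<^esub>?X"
      using double_pseudocomplement_mono[of "\<Squnion>A" "\<Squnion>\<^bsub>?B\<^esub>?X"] A s by simp
  qed (use s in auto)
qed

lemma double_pseudocomplement_frame_hom:
  "(\<lambda>a. pc (pc a)) \<in> frame_hom L (L\<lparr>carrier := booleanization L\<rparr>)"
proof -
  have "pc (pc \<top>) = \<top>"
    using le_double_pseudocomplement[of \<top>] by (intro le_antisym) auto
  then show ?thesis
    by (auto simp: frame_hom_def sublocale_top sublocale_meet is_sublocale_booleanization
        double_pseudocomplement_meet booleanization_sup pseudocomplement_mem_booleanization)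
qed

section \<open>Boolean dense sublocales\<close>

lemma boolean_frame_booleanization: "boolean_frame (L\<lparr>carrier := booleanization L\<rparr>)"
  unfolding boolean_frame_def
proof (intro conjI ballI)
  let ?B = "L\<lparr>carrier := booleanization L\<rparr>"
  show "frame ?B" by (rule frame_sublocale[OF is_sublocale_booleanization])
  fix x assume "x \<in> carrier ?B"
  then have xB: "x \<in> booleanization L" and x: "x \<in> carrier L" and reg: "pc (pc x) = x"
    by (auto simp: mem_booleanization_iff)
  have pB: "pc x \<in> booleanization L" by (rule pseudocomplement_mem_booleanization[OF x])
  have "x \<sqinter>\<^bsub>?B\<^esub> pc x = \<bottom>\<^bsub>?B\<^esub>"
    using sublocale_meet[OF is_sublocale_booleanization xB pB] meet_pseudocomplement[OF x]
      dense_sublocale_bottom[OF dense_sublocale_booleanization] meet_comm[of L x] by simp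
  moreover have "x \<squnion>\<^bsub>?B\<^esub> pc x = \<top>\<^bsub>?B\<^esub>"
  proof -
    \<comment> \<open>The join \<open>?j\<close> in \<open>L\<close> may fall short of
      \<open>\<top>\<close>, but \<open>pc ?j\<close> lies below both \<open>pc x\<close> and
      \<open>pc (pc x)\<close> and so vanishes. Hence \<open>pc (pc ?j)\<close>, the join in the
      booleanization, is \<open>\<top>\<close>.\<close>
    let ?j = "\<Squnion>{x, pc x}"
    have A: "{x, pc x} \<subseteq> carrier L" using x by simp
    have "pc ?j \<sqsubseteq> pc x" "pc ?j \<sqsubseteq> pc (pc x)"
      using A sup_upper[OF A] by (auto intro!: pseudocomplement_antimono simp del: insert_subset)
    then have "pc ?j \<sqsubseteq> pc (pc x) \<sqinter> pc x" by (intro meet_le) auto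
    then have "pc ?j = \<bottom>" using meet_pseudocomplement[of "pc x"] le_bottom_iff by simp
    then have "pc (pc ?j) = \<top>" by (simp add: pseudocomplement_bottom)
    moreover have "(\<lambda>a. pc (pc a)) ` {x, pc x} = {x, pc x}"
      using reg by simp
    ultimately show ?thesis
      using booleanization_sup[OF A] sublocale_top[OF is_sublocale_booleanization]
      by (simp add: join_def)
  qed
  ultimately show "\<exists>y\<in>carrier ?B. x \<sqinter>\<^bsub>?B\<^esub> y = \<bottom>\<^bsub>?B\<^esub> \<and> x \<squnion>\<^bsub>?B\<^esub> y = \<top>\<^bsub>?B\<^esub>"
    using pB by auto
qed

text \<open>Let \<open>b\<close> be a complement of \<open>a\<close> in \<open>S\<close>. Then
  \<open>pc (pc a)\<close> lies in \<open>S\<close> and is disjoint from \<open>b\<close> because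
  \<open>a\<close> is. Distributing it, inside \<open>S\<close>, over the join of \<open>a\<close>
  and \<open>b\<close> leaves only its part in \<open>a\<close>, so \<open>a\<close> is
  regular.\<close>

lemma boolean_dense_sublocale_eq_booleanization:
  assumes d: "dense_sublocale L S" and bool: "boolean_frame (L\<lparr>carrier := S\<rparr>)"
  shows "S = booleanization L"
proof
  let ?S = "L\<lparr>carrier := S\<rparr>"
  have S: "is_sublocale L S" using d by (simp add: dense_sublocale_def)
  then have sub: "S \<subseteq> carrier L" unfolding is_sublocale_def by auto
  interpret S: frame ?S by (rule frame_sublocale[OF S])
  show BS: "booleanization L \<subseteq> S" by (rule booleanization_subset_dense_sublocale[OF d])
  show "S \<subseteq> booleanization L"
  proof
    fix a assume a: "a \<in> S"
    then obtain b where b: "b \<in> S" "a \<sqinter>\<^bsub>?S\<^esub> b = \<bottom>\<^bsub>?S\<^esub>" "a \<squnion>\<^bsub>?S\<^esub> b = \<top>\<^bsub>?S\<^esub>"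
      using bool unfolding boolean_frame_def by auto
    have c: "a \<in> carrier L" "b \<in> carrier L" using a b sub by auto
    let ?d = "pc (pc a)"
    have dS: "?d \<in> S" using BS pseudocomplement_mem_booleanization by auto
    have "b \<sqinter> a = \<bottom>"
      using b(2) sublocale_meet[OF S a b(1)] dense_sublocale_bottom[OF d] meet_comm[of L a] by simp
    then have "b \<sqinter> ?d = \<bottom>" using meet_double_pseudocomplement_eq_bottom c by simp
    then have db: "?d \<sqinter>\<^bsub>?S\<^esub> b = \<bottom>"
      using sublocale_meet[OF S dS b(1)] meet_comm[of L b] by simp
    have da: "?d \<sqinter>\<^bsub>?S\<^esub> a = a"
      using sublocale_meet[OF S dS a] le_double_pseudocomplement[OF c(1)] c
      by (metis le_iff_join meet_comm pseudocomplement_closed)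
    have "?d = ?d \<sqinter>\<^bsub>?S\<^esub> \<Squnion>\<^bsub>?S\<^esub>{a, b}"
      using S.le_iff_join[of ?d "\<top>\<^bsub>?S\<^esub>"] S.top_higher[of ?d] dS b(3) S.top_closed
      by (simp add: join_def)
    also have "\<dots> = \<Squnion>\<^bsub>?S\<^esub>((\<lambda>x. ?d \<sqinter>\<^bsub>?S\<^esub> x) ` {a, b})"
      using S.meet_sup_distrib[of ?d "{a, b}"] dS a b(1) by simp
    also have "\<dots> = \<Squnion>\<^bsub>?S\<^esub>{a, \<bottom>}" using da db by simp
    finally have eq: "?d = \<Squnion>\<^bsub>?S\<^esub>{a, \<bottom>}" .
    have "\<Squnion>\<^bsub>?S\<^esub>{a, \<bottom>} \<sqsubseteq>\<^bsub>?S\<^esub> a"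
      by (rule S.sup_least) (use a c d in \<open>auto simp: dense_sublocale_def\<close>)
    then have "?d \<sqsubseteq> a" using eq by simp
    then show "a \<in> booleanization L"
      using c le_double_pseudocomplement[of a]
      by (auto simp: mem_booleanization_iff intro: le_antisym)
  qed
qed

section \<open>Density of the perfect regularization\<close>

lemma bottom_mem_Coz: "\<bottom> \<in> Coz L"
proof -
  \<comment> \<open>This is the frame form of the constant function 0: an open set is sent to
    \<open>\<top>\<close> exactly when it contains 0, so \<open>UNIV - {0}\<close> is sent to
    \<open>\<bottom>\<close>.\<close>
  let ?h = "\<lambda>U :: real set. if 0 \<in> U then \<top> else \<bottom>"
  have "?h (\<Squnion>\<^bsub>open_frame\<^esub>A) = \<Squnion>(?h ` A)" if "A \<subseteq> carrier open_frame" for A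
  proof -
    have sup: "\<Squnion>\<^bsub>open_frame\<^esub>A = \<Union>A"
      by (rule open_frame_sup) (use that in \<open>auto simp: open_frame_def\<close>)
    have im: "?h ` A \<subseteq> carrier L" by auto
    show ?thesis
    proof (cases "0 \<in> \<Union>A")
      case True
      then have "\<top> \<in> ?h ` A" by force
      then have "\<top> \<sqsubseteq> \<Squnion>(?h ` A)" by (rule sup_upper[OF im])
      then have "\<Squnion>(?h ` A) = \<top>" by (intro le_antisym) (auto intro!: sup_closed top_higher)
      with True sup show ?thesis by simp
    next
      case False
      then have "\<Squnion>(?h ` A) \<sqsubseteq> \<bottom>" by (intro sup_least[OF im]) auto
      then have "\<Squnion>(?h ` A) = \<bottom>" using le_bottom_iff[OF sup_closed[OF im]] by simp
      with False sup show ?thesis by simp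
    qed
  qed
  moreover have "?h (U \<sqinter>\<^bsub>open_frame\<^esub> V) = ?h U \<sqinter> ?h V"
    if "U \<in> carrier open_frame" "V \<in> carrier open_frame" for U V
  proof -
    have "U \<sqinter>\<^bsub>open_frame\<^esub> V = U \<inter> V"
      by (rule open_frame_meet) (use that in \<open>auto simp: open_frame_def\<close>)
    moreover have "\<top> \<sqinter> x = x" "\<bottom> \<sqinter> x = \<bottom>" "x \<sqinter> \<bottom> = \<bottom>" if "x \<in> carrier L" for x
      using that le_iff_join[of x \<top>] le_iff_join[of \<bottom> x] meet_comm[of L] by auto
    ultimately show ?thesis by auto
  qed
  ultimately have "?h \<in> frame_hom open_frame L"
    by (auto simp: frame_hom_def open_frame_top)
  then show ?thesis unfolding Coz_def by (intro CollectI exI[of _ ?h]) auto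
qed

lemma dense_sublocale_perfect_regularization: "dense_sublocale L (perfect_regularization L)"
  using is_sublocale_perfect_regularization Coz_subset_perfect_regularization bottom_mem_Coz
  by (auto simp: dense_sublocale_def)

section \<open>Reduction of each condition to regularity of all cozero elements\<close>

lemma well_embedded_booleanization_iff:
  "well_embedded L (booleanization L) \<longleftrightarrow> Coz L \<subseteq> booleanization L"
proof
  interpret B: frame "L\<lparr>carrier := booleanization L\<rparr>"
    by (rule frame_sublocale[OF is_sublocale_booleanization])
  show "Coz L \<subseteq> booleanization L" if "well_embedded L (booleanization L)"
    using that B.Coz_subset unfolding well_embedded_def by auto
  assume reg: "Coz L \<subseteq> booleanization L"
  have "a \<in> Coz (L\<lparr>carrier := booleanization L\<rparr>)" if "a \<in> Coz L" for a
    using frame_hom_Coz[OF double_pseudocomplement_frame_hom that] reg that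
    by (auto simp: mem_booleanization_iff)
  then show "well_embedded L (booleanization L)"
    using dense_sublocale_booleanization by (auto simp: well_embedded_def)
qed

text \<open>Density gives one inclusion outright. By leastness the other holds exactly when the
  sublocale \<open>booleanization L\<close> contains \<open>Coz L\<close>.\<close>

lemma perfect_regularization_eq_booleanization_iff:
  "perfect_regularization L = booleanization L \<longleftrightarrow> Coz L \<subseteq> booleanization L"
  using Coz_subset_perfect_regularization
    perfect_regularization_least[OF is_sublocale_booleanization]
    booleanization_subset_dense_sublocale[OF dense_sublocale_perfect_regularization]
  by auto

lemma boolean_frame_perfect_regularization_iff:
  "boolean_frame (L\<lparr>carrier := perfect_regularization L\<rparr>)
    \<longleftrightarrow> perfect_regularization L = booleanization L"
  using boolean_dense_sublocale_eq_booleanization[OF dense_sublocale_perfect_regularization]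
    boolean_frame_booleanization by auto

lemma meet_subfit_Coz_iff:
  assumes cr: "completely_regular L"
  shows "meet_subfit L (Coz L) \<longleftrightarrow> Coz L \<subseteq> booleanization L"
proof
  assume sf: "meet_subfit L (Coz L)"
  show "Coz L \<subseteq> booleanization L"
  proof
    fix a assume aC: "a \<in> Coz L"
    then have a: "a \<in> carrier L" using Coz_subset by auto
    \<comment> \<open>Subfitness speaks only of cozero elements and \<open>pc (pc a)\<close> is not
      known to be one, so it is compared with \<open>a\<close> through cozero elements covering
      it.\<close>
    obtain C where C: "C \<subseteq> Coz L" "pc (pc a) = \<Squnion>C"
      using cr pseudocomplement_closed unfolding completely_regular_def by metis
    have Cc: "C \<subseteq> carrier L" using C(1) Coz_subset by auto
    have "c \<sqsubseteq> a" if c: "c \<in> C" for c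
    proof (rule ccontr)
      assume "\<not> c \<sqsubseteq> a"
      then obtain d where d: "d \<in> Coz L" "d \<sqinter> c \<noteq> \<bottom>" "d \<sqinter> a = \<bottom>"
        using sf c C(1) aC unfolding meet_subfit_def by blast
      have dc: "d \<in> carrier L" and cc: "c \<in> carrier L" using d(1) Coz_subset c Cc by auto
      \<comment> \<open>An element \<open>d\<close> disjoint from \<open>a\<close> is disjoint from
        \<open>pc (pc a)\<close> as well, hence from \<open>c\<close>, against the choice of
        \<open>d\<close>.\<close>
      have "c \<sqsubseteq> pc (pc a)" using sup_upper[OF Cc c] C(2) by simp
      moreover have "pc (pc a) \<sqsubseteq> pc d"
        using d(3) a dc by (intro pseudocomplement_antimono) (auto simp: le_pseudocomplement_iff)
      ultimately have "c \<sqsubseteq> pc d" using cc by (meson le_trans pseudocomplement_closed)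
      then show False
        using d(2) dc cc by (simp add: le_pseudocomplement_iff meet_comm[of L c])
    qed
    then have "pc (pc a) \<sqsubseteq> a" unfolding C(2) by (intro sup_least Cc a)
    then show "a \<in> booleanization L"
      using a le_double_pseudocomplement[of a]
      by (auto simp: mem_booleanization_iff intro: le_antisym)
  qed
next
  assume reg: "Coz L \<subseteq> booleanization L"
  show "meet_subfit L (Coz L)"
    unfolding meet_subfit_def
  proof (intro ballI impI)
    fix a b assume ab: "a \<in> Coz L" "b \<in> Coz L" and nle: "\<not> a \<sqsubseteq> b"
    have a: "a \<in> carrier L" and b: "b \<in> carrier L" using ab Coz_subset by auto
    have "pc (pc b) = b" using reg ab(2) by (auto simp: mem_booleanization_iff)
    \<comment> \<open>Disjointness of \<open>a\<close> from \<open>pc b\<close> would put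
      \<open>a\<close> below \<open>pc (pc b) = b\<close>.\<close>
    then have ne: "a \<sqinter> pc b \<noteq> \<bottom>"
      using nle le_pseudocomplement_iff[of "pc b" a] a by simp
    \<comment> \<open>The natural witness \<open>pc b\<close> need not be cozero; complete
      regularity supplies a cozero \<open>c\<close> below it that still meets
      \<open>a\<close>.\<close>
    obtain C where C: "C \<subseteq> Coz L" "pc b = \<Squnion>C"
      using cr pseudocomplement_closed unfolding completely_regular_def by metis
    have Cc: "C \<subseteq> carrier L" using C(1) Coz_subset by auto
    obtain c where c: "c \<in> C" "a \<sqinter> c \<noteq> \<bottom>"
      using meet_sup_neq_bottom[OF a Cc] ne C(2) by auto
    have "c \<sqsubseteq> pc b" using sup_upper[OF Cc c(1)] C(2) by simp
    then have "c \<sqinter> b = \<bottom>" using le_pseudocomplement_iff[of b c] b c(1) Cc by auto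
    then show "\<exists>c\<in>Coz L. c \<sqinter> a \<noteq> \<bottom> \<and> c \<sqinter> b = \<bottom>"
      using c C(1) meet_comm[of L a] by auto
  qed
qed

end

theorem theorem3p11:
  fixes L :: "('a, 'c) gorder_scheme"
  assumes "completely_regular L"
  shows "(almost_P_frame L \<longleftrightarrow> well_embedded L (booleanization L))
       \<and> (well_embedded L (booleanization L) \<longleftrightarrow> perfect_regularization L = booleanization L)
       \<and> (perfect_regularization L = booleanization L
            \<longleftrightarrow> boolean_frame (L\<lparr>carrier := perfect_regularization L\<rparr>))
       \<and> (boolean_frame (L\<lparr>carrier := perfect_regularization L\<rparr>) \<longleftrightarrow> meet_subfit L (Coz L))"
proof -
  interpret frame L using assms by (simp add: completely_regular_def)
  \<comment> \<open>Every condition rewrites to \<open>Coz L \<subseteq> booleanization L\<close>,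
    booleanness of the perfect regularization by way of the equality of the two sublocales.\<close>
  show ?thesis
    by (simp add: almost_P_frame_def frame_axioms well_embedded_booleanization_iff
        perfect_regularization_eq_booleanization_iff boolean_frame_perfect_regularization_iff
        meet_subfit_Coz_iff[OF assms])
qed

end
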